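(* Let $p,q\in[2,\infty]$ with $\frac1p+\frac1q<1$ and set $\lambda=\frac{1}{1-\frac1p-\frac1q}$ (i.e. $\lambda=\frac{pq}{pq-p-q}$ for finite $p,q$). Then there is a constant $C\ge1$ such that \[ \Big(\sum_{k=1}^\infty\Big(\sum_{j=1}^\infty|A(e_j,e_k)|^2\Big)^{\frac\lambda2}\Big)^{\frac1\lambda}\le C\|A\| \] for all continuous bilinear forms $A:X_p\times X_q\to\mathbb{K}$. Moreover the exponents are optimal in the following sense: for no $s<\lambda$ is there a constant $C$ with $\big(\sum_k(\sum_j|A(e_j,e_k)|^2)^{s/2}\big)^{1/s}\le C\|A\|$ for all such $A$, and for no $r<2$ is there a constant $C$ with $\big(\sum_k(\sum_j|A(e_j,e_k)|^r)^{\lambda/r}\big)^{1/\lambda}\le C\|A\|$ for all such $A$.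
   Context: $\mathbb{K}$ denotes $\mathbb{R}$ or $\mathbb{C}$. $X_p=\ell_p$ for $p<\infty$ and $X_\infty=c_0$ (similarly for $q$); $e_j$ denote the canonical unit vectors; $1/\infty=0$; $\|A\|=\sup\{|A(x,y)|:\|x\|\le1,\|y\|\le1\}$. *)

theory Defs
  imports "HOL-Analysis.Analysis"
begin

definition inv_exp :: "ereal \<Rightarrow> real" where
  "inv_exp p = (if p = \<infinity> then 0 else 1 / real_of_ereal p)"

definition X_space :: "ereal \<Rightarrow> (nat \<Rightarrow> 'k::real_normed_field) set" where
  "X_space p = (if p = \<infinity> then {x. x \<longlonglongrightarrow> 0}
                else {x. summable (\<lambda>n. norm (x n) powr real_of_ereal p)})"

definition X_norm :: "ereal \<Rightarrow> (nat \<Rightarrow> 'k::real_normed_field) \<Rightarrow> real" where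
  "X_norm p x = (if p = \<infinity> then (SUP n. norm (x n))
                 else (\<Sum>n. norm (x n) powr real_of_ereal p) powr (1 / real_of_ereal p))"

definition unit_vec :: "nat \<Rightarrow> nat \<Rightarrow> 'k::real_normed_field" where
  "unit_vec j = (\<lambda>n. if n = j then 1 else 0)"

definition cont_bilinear_form ::
  "ereal \<Rightarrow> ereal \<Rightarrow> ((nat \<Rightarrow> 'k::real_normed_field) \<Rightarrow> (nat \<Rightarrow> 'k) \<Rightarrow> 'k) \<Rightarrow> bool" where
  "cont_bilinear_form p q A \<longleftrightarrow>
     (\<forall>x\<in>X_space p. \<forall>x'\<in>X_space p. \<forall>y\<in>X_space q. \<forall>c d.
         A (\<lambda>n. c * x n + d * x' n) y = c * A x y + d * A x' y) \<and>
     (\<forall>x\<in>X_space p. \<forall>y\<in>X_space q. \<forall>y'\<in>X_space q. \<forall>c d.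
         A x (\<lambda>n. c * y n + d * y' n) = c * A x y + d * A x y') \<and>
     (\<exists>M. \<forall>x\<in>X_space p. \<forall>y\<in>X_space q. norm (A x y) \<le> M * X_norm p x * X_norm q y)"

definition bil_norm ::
  "ereal \<Rightarrow> ereal \<Rightarrow> ((nat \<Rightarrow> 'k::real_normed_field) \<Rightarrow> (nat \<Rightarrow> 'k) \<Rightarrow> 'k) \<Rightarrow> real" where
  "bil_norm p q A = Sup {norm (A x y) | x y. x \<in> X_space p \<and> y \<in> X_space q \<and>
                                        X_norm p x \<le> 1 \<and> X_norm q y \<le> 1}"

definition mixed_le ::
  "real \<Rightarrow> real \<Rightarrow> ((nat \<Rightarrow> 'k::real_normed_field) \<Rightarrow> (nat \<Rightarrow> 'k) \<Rightarrow> 'k) \<Rightarrow> real \<Rightarrow> bool" where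
  "mixed_le r s A B \<longleftrightarrow>
     (\<forall>k. summable (\<lambda>j. norm (A (unit_vec j) (unit_vec k)) powr r)) \<and>
     summable (\<lambda>k. (\<Sum>j. norm (A (unit_vec j) (unit_vec k)) powr r) powr (s / r)) \<and>
     (\<Sum>k. (\<Sum>j. norm (A (unit_vec j) (unit_vec k)) powr r) powr (s / r)) powr (1 / s) \<le> B"

end

theory Submission
  imports Defs
begin

text \<open>
  The upper bound first reduces to \<open>q = \<infinity>\<close>: multiplying the columns by a sequence in \<open>\<ell>\<^sub>q\<close> and
  dualising turns the exponent \<open>u = p / (p - 1)\<close> into \<open>\<lambda>\<close>. Put \<open>d j k = |A(e\<^sub>j, e\<^sub>k)|\<close> and
  \<open>c j = (\<Sum>k. (d j k)\<^sup>2)^(1/2)\<close>. Khinchin's \<open>L\<^sub>1\<close> inequality, applied to random signs in either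
  variable, gives both \<open>(\<Sum>k. (\<Sum>j. (x j * d j k)\<^sup>2)^(1/2)) \<le> Q * norm x\<close> for \<open>x\<close> in \<open>\<ell>\<^sub>p\<close> and
  \<open>(\<Sum>j. c j ^ u) \<le> Q ^ u\<close>. Taking \<open>x j = c j ^ (u - 1)\<close> in the former and interpolating, by
  Hoelder's inequality, with the identity \<open>(\<Sum>k. \<Sum>j. c j ^ (u - 2) * (d j k)\<^sup>2) = (\<Sum>j. c j ^ u)\<close>
  yields \<open>(\<Sum>k. (\<Sum>j. (d j k)\<^sup>2)^(u/2)) \<le> Q ^ u\<close>.

  Optimality of \<open>\<lambda>\<close> is seen on the diagonal forms \<open>\<Sum>j<n. x j * y j\<close>, whose norm is at most
  \<open>n^(1/\<lambda>)\<close>, and optimality of \<open>2\<close> on the Sylvester--Hadamard matrices, whose norm is at most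
  \<open>n^(1/2 + 1/\<lambda>)\<close>. Real and complex scalars are treated together as a normed field that is a
  real inner product space.
\<close>

subsection \<open>Khinchin's inequality\<close>

lemma sum_Pow_insert:
  assumes "finite A" "x \<notin> A"
  shows "(\<Sum>S\<in>Pow (insert x A). f S) = (\<Sum>S\<in>Pow A. f S + f (insert x S))"
proof -
  have "inj_on (insert x) (Pow A)"
    using assms by (auto simp: inj_on_def)
  moreover have "Pow A \<inter> insert x ` Pow A = {}"
    using assms by auto
  ultimately show ?thesis
    using assms by (simp add: Pow_insert sum.union_disjoint sum.reindex sum.distrib)
qed

text \<open>A choice of signs on a finite set is encoded by the subset on which the sign is +1, so
  that an expectation over random signs becomes a finite sum over \<open>Pow A\<close> divided by
  \<open>2 ^ card A\<close>.\<close>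

definition rademacher :: "'i set \<Rightarrow> 'i \<Rightarrow> real" where
  "rademacher S j = (if j \<in> S then 1 else -1)"

lemma abs_rademacher [simp]: "\<bar>rademacher S j\<bar> = 1"
  by (simp add: rademacher_def)

lemma rademacher_sum_insert:
  fixes a :: "'i \<Rightarrow> 'v::real_vector"
  assumes "finite A" "x \<notin> A" "S \<subseteq> A"
  shows "(\<Sum>j\<in>insert x A. rademacher S j *\<^sub>R a j) = (\<Sum>j\<in>A. rademacher S j *\<^sub>R a j) - a x"
    and "(\<Sum>j\<in>insert x A. rademacher (insert x S) j *\<^sub>R a j)
           = (\<Sum>j\<in>A. rademacher S j *\<^sub>R a j) + a x"
proof -
  have "(\<Sum>j\<in>A. rademacher (insert x S) j *\<^sub>R a j) = (\<Sum>j\<in>A. rademacher S j *\<^sub>R a j)"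
    using assms by (intro sum.cong) (auto simp: rademacher_def)
  moreover have "x \<notin> S"
    using assms by auto
  ultimately show "(\<Sum>j\<in>insert x A. rademacher S j *\<^sub>R a j) = (\<Sum>j\<in>A. rademacher S j *\<^sub>R a j) - a x"
    "(\<Sum>j\<in>insert x A. rademacher (insert x S) j *\<^sub>R a j) = (\<Sum>j\<in>A. rademacher S j *\<^sub>R a j) + a x"
    using assms by (simp_all add: rademacher_def)
qed

lemma parallelogram_law:
  fixes x y :: "'v::real_inner"
  shows "(norm (x - y))\<^sup>2 + (norm (x + y))\<^sup>2 = 2 * (norm x)\<^sup>2 + 2 * (norm y)\<^sup>2"
  by (simp add: power2_norm_eq_inner inner_diff inner_add inner_commute)

text \<open>With (norm (x - y))^2 and (norm (x + y))^2 expanded by the inner product, squaring and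
  adding cancels the odd terms. Cauchy-Schwarz bounds the remaining 8 (inner x y)^2, which raises
  the mixed coefficient from 4 to 12.\<close>

lemma norm_fourth_power_sum_le:
  fixes x y :: "'v::real_inner"
  shows "norm (x - y) ^ 4 + norm (x + y) ^ 4
           \<le> 2 * norm x ^ 4 + 12 * ((norm x)\<^sup>2 * (norm y)\<^sup>2) + 2 * norm y ^ 4"
proof -
  have e4: "t ^ 4 = (t\<^sup>2)\<^sup>2" for t :: real
    by simp
  have eq: "(norm (x - y))\<^sup>2 = (norm x)\<^sup>2 + (norm y)\<^sup>2 - 2 * inner x y"
    "(norm (x + y))\<^sup>2 = (norm x)\<^sup>2 + (norm y)\<^sup>2 + 2 * inner x y"
    by (simp_all add: power2_norm_eq_inner inner_diff inner_add inner_commute)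
  have "norm (x - y) ^ 4 + norm (x + y) ^ 4
      = 2 * ((norm x)\<^sup>2 + (norm y)\<^sup>2)\<^sup>2 + 8 * (inner x y)\<^sup>2"
    unfolding e4 eq by (simp add: power2_eq_square algebra_simps)
  moreover have "(inner x y)\<^sup>2 \<le> (norm x)\<^sup>2 * (norm y)\<^sup>2"
    using power_mono[OF Cauchy_Schwarz_ineq2[of x y] abs_ge_zero, of 2]
    by (simp add: power_mult_distrib)
  ultimately show ?thesis
    unfolding e4 by (simp add: power2_sum)
qed

text \<open>Distinct signs are orthogonal. In the induction, the two signs of the new term are
  paired and the parallelogram law removes the cross terms.\<close>

lemma rademacher_second_moment:
  fixes a :: "'i \<Rightarrow> 'v::real_inner"
  assumes "finite A"
  shows "(\<Sum>S\<in>Pow A. (norm (\<Sum>j\<in>A. rademacher S j *\<^sub>R a j))\<^sup>2)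
           = 2 ^ card A * (\<Sum>j\<in>A. (norm (a j))\<^sup>2)"
  using assms
proof (induction A rule: finite_induct)
  case empty
  then show ?case by simp
next
  case (insert x A)
  have "(\<Sum>S\<in>Pow (insert x A). (norm (\<Sum>j\<in>insert x A. rademacher S j *\<^sub>R a j))\<^sup>2)
      = (\<Sum>S\<in>Pow A. 2 * (norm (\<Sum>j\<in>A. rademacher S j *\<^sub>R a j))\<^sup>2 + 2 * (norm (a x))\<^sup>2)"
    using insert.hyps
    by (subst sum_Pow_insert)
      (auto intro!: sum.cong simp: rademacher_sum_insert parallelogram_law simp del: sum.insert)
  then show ?case
    using insert by (simp add: sum.distrib sum_distrib_left[symmetric] card_Pow algebra_simps)
qed

text \<open>The same pairing of the two signs of the new term gives a recursion that involves the
  second moment, which is known exactly.\<close>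

lemma rademacher_fourth_moment:
  fixes a :: "'i \<Rightarrow> 'v::real_inner"
  assumes "finite A"
  shows "(\<Sum>S\<in>Pow A. norm (\<Sum>j\<in>A. rademacher S j *\<^sub>R a j) ^ 4)
           \<le> 2 ^ card A * (3 * (\<Sum>j\<in>A. (norm (a j))\<^sup>2)\<^sup>2)"
  using assms
proof (induction A rule: finite_induct)
  case empty
  then show ?case by simp
next
  case (insert x A)
  define T where "T S = norm (\<Sum>j\<in>A. rademacher S j *\<^sub>R a j)" for S
  define s where "s = (\<Sum>j\<in>A. (norm (a j))\<^sup>2)"
  define b where "b = (norm (a x))\<^sup>2"
  have b4: "norm (a x) ^ 4 = b\<^sup>2"
    by (simp add: b_def)
  have m2: "(\<Sum>S\<in>Pow A. (T S)\<^sup>2) = 2 ^ card A * s"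
    unfolding T_def s_def by (rule rademacher_second_moment[OF insert.hyps(1)])
  have m4: "(\<Sum>S\<in>Pow A. T S ^ 4) \<le> 2 ^ card A * (3 * s\<^sup>2)"
    unfolding T_def s_def by (rule insert.IH)
  have "(\<Sum>S\<in>Pow (insert x A). norm (\<Sum>j\<in>insert x A. rademacher S j *\<^sub>R a j) ^ 4)
      \<le> (\<Sum>S\<in>Pow A. 2 * T S ^ 4 + 12 * ((T S)\<^sup>2 * b) + 2 * norm (a x) ^ 4)"
    unfolding T_def b_def using insert.hyps
    by (subst sum_Pow_insert)
      (auto intro!: sum_mono norm_fourth_power_sum_le simp: rademacher_sum_insert simp del: sum.insert)
  also have "\<dots> = 2 * (\<Sum>S\<in>Pow A. T S ^ 4) + 12 * b * (\<Sum>S\<in>Pow A. (T S)\<^sup>2) + 2 ^ card A * (2 * b\<^sup>2)"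
    using insert.hyps
    by (simp add: sum.distrib sum_distrib_left card_Pow b4 mult_ac)
  also have "\<dots> \<le> 2 * (2 ^ card A * (3 * s\<^sup>2)) + 12 * b * (2 ^ card A * s) + 2 ^ card A * (2 * b\<^sup>2)"
    unfolding m2 using m4 by (intro add_mono mult_left_mono) (auto simp: b_def)
  also have "\<dots> = 2 ^ card A * (6 * s\<^sup>2 + 12 * b * s + 2 * b\<^sup>2)"
    by (simp add: algebra_simps)
  \<comment> \<open>The factor 3 is the smallest for which the induction closes: doubling it gives
    6, and the mixed term 12 b s then matches that of 6 (b + s)^2 exactly.\<close>
  also have "\<dots> \<le> 2 ^ card A * (6 * (b + s)\<^sup>2)"
    by (intro mult_left_mono) (auto simp: power2_sum)
  also have "\<dots> = 2 ^ card (insert x A) * (3 * (\<Sum>j\<in>insert x A. (norm (a j))\<^sup>2)\<^sup>2)"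
    using insert.hyps by (simp add: s_def b_def)
  finally show ?case .
qed

text \<open>The difference of the two sides is 4/27 t (t - 3/2)^2 (t + 3). The constant 4/27 is the
  least possible, with contact at t = 3/2.\<close>

lemma quartic_le_self:
  fixes t :: real
  assumes "0 \<le> t"
  shows "t\<^sup>2 - 4 / 27 * t ^ 4 \<le> t"
proof -
  have "0 \<le> 4 / 27 * t * ((t - 3 / 2)\<^sup>2 * (t + 3))"
    using assms by (intro mult_nonneg_nonneg) auto
  also have "\<dots> = t - (t\<^sup>2 - 4 / 27 * t ^ 4)"
    by (simp add: power2_eq_square power4_eq_xxxx field_simps)
  finally show ?thesis by simp
qed

text \<open>The first moment is bounded below through the second and fourth moments by means of
  the pointwise bound \<open>t\<^sup>2 - 4/27 t\<^sup>4 \<le> t\<close>.\<close>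

lemma khinchin_L1:
  fixes a :: "'i \<Rightarrow> 'v::real_inner"
  assumes "finite A"
  shows "2 ^ card A * sqrt (\<Sum>j\<in>A. (norm (a j))\<^sup>2)
           \<le> 9 / 5 * (\<Sum>S\<in>Pow A. norm (\<Sum>j\<in>A. rademacher S j *\<^sub>R a j))"
proof (cases "(\<Sum>j\<in>A. (norm (a j))\<^sup>2) = 0")
  case True
  then show ?thesis by (simp add: sum_nonneg)
next
  case False
  define s where "s = sqrt (\<Sum>j\<in>A. (norm (a j))\<^sup>2)"
  define T where "T S = norm (\<Sum>j\<in>A. rademacher S j *\<^sub>R a j)" for S
  have s2: "s\<^sup>2 = (\<Sum>j\<in>A. (norm (a j))\<^sup>2)"
    by (simp add: s_def sum_nonneg)
  have s: "s > 0"
    using False by (simp add: s_def sum_nonneg less_le)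
  have m2: "(\<Sum>S\<in>Pow A. (T S)\<^sup>2) = 2 ^ card A * s\<^sup>2"
    unfolding T_def s2 by (rule rademacher_second_moment[OF assms])
  have m4: "(\<Sum>S\<in>Pow A. T S ^ 4) \<le> 2 ^ card A * (3 * s ^ 4)"
    using rademacher_fourth_moment[OF assms, of a] unfolding T_def s2[symmetric] by simp
  \<comment> \<open>The pointwise bound is applied to \<open>T S / s\<close>, whose mean square is 1
    and whose mean fourth power is at most 3. This leaves 1 - 3 * 4/27 = 5/9, hence the Khinchin
    constant 9/5.\<close>
  have "5 / 9 * (2 ^ card A * s) = 2 ^ card A * s\<^sup>2 / s - 4 / 27 * (2 ^ card A * (3 * s ^ 4)) / s ^ 3"
    using s by (simp add: field_simps power2_eq_square power3_eq_cube power4_eq_xxxx)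
  also have "\<dots> \<le> 2 ^ card A * s\<^sup>2 / s - 4 / 27 * (\<Sum>S\<in>Pow A. T S ^ 4) / s ^ 3"
    using m4 s by (intro diff_left_mono divide_right_mono mult_left_mono) auto
  also have "\<dots> = (\<Sum>S\<in>Pow A. (T S)\<^sup>2 / s - 4 / 27 * T S ^ 4 / s ^ 3)"
    by (simp add: m2[symmetric] sum_subtractf sum_divide_distrib sum_distrib_left)
  also have "\<dots> \<le> (\<Sum>S\<in>Pow A. T S)"
  proof (rule sum_mono)
    fix S
    have "(T S)\<^sup>2 / s - 4 / 27 * T S ^ 4 / s ^ 3 = s * ((T S / s)\<^sup>2 - 4 / 27 * (T S / s) ^ 4)"
      using s by (simp add: field_simps power2_eq_square power3_eq_cube power4_eq_xxxx)
    also have "\<dots> \<le> s * (T S / s)"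
      using s by (intro mult_left_mono quartic_le_self) (auto simp: T_def)
    finally show "(T S)\<^sup>2 / s - 4 / 27 * T S ^ 4 / s ^ 3 \<le> T S"
      using s by simp
  qed
  finally show ?thesis
    by (simp add: s_def T_def)
qed

subsection \<open>Bounded matrices\<close>

lemma weighted_am_gm:
  fixes a b t :: real
  assumes "0 \<le> t" "t \<le> 1" "0 \<le> a" "0 \<le> b"
  shows "a powr t * b powr (1 - t) \<le> t * a + (1 - t) * b"
  \<comment> \<open>If a factor vanishes, so does the left side, since \<open>0 powr t = 0\<close>
    even for t = 0.\<close>
  using Youngs_inequality_0[of t "1 - t" a b] assms by (cases "a = 0 \<or> b = 0") auto

text \<open>Hoelder's inequality with conjugate exponents 1/t and 1/(1 - t), stated so that the
  endpoints t = 0 and t = 1 are included. After both sums are normalised to 1, weighted AM-GM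
  applies term by term.\<close>

lemma holder_sum:
  fixes f g :: "'i \<Rightarrow> real"
  assumes t: "0 \<le> t" "t \<le> 1" and f: "\<And>i. i \<in> A \<Longrightarrow> 0 \<le> f i" and g: "\<And>i. i \<in> A \<Longrightarrow> 0 \<le> g i"
  shows "(\<Sum>i\<in>A. f i powr t * g i powr (1 - t)) \<le> (\<Sum>i\<in>A. f i) powr t * (\<Sum>i\<in>A. g i) powr (1 - t)"
proof (cases "finite A \<and> (\<Sum>i\<in>A. f i) \<noteq> 0 \<and> (\<Sum>i\<in>A. g i) \<noteq> 0")
  case True
  define F where "F = (\<Sum>i\<in>A. f i)"
  define G where "G = (\<Sum>i\<in>A. g i)"
  have pos: "F > 0" "G > 0"
    using True f g by (auto simp: F_def G_def less_le intro!: sum_nonneg)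
  have "(\<Sum>i\<in>A. f i powr t * g i powr (1 - t))
      = F powr t * G powr (1 - t) * (\<Sum>i\<in>A. (f i / F) powr t * (g i / G) powr (1 - t))"
    unfolding sum_distrib_left
    using pos f g by (intro sum.cong) (auto simp: powr_divide)
  also have "\<dots> \<le> F powr t * G powr (1 - t) * (\<Sum>i\<in>A. t * (f i / F) + (1 - t) * (g i / G))"
    using pos f g t by (intro mult_left_mono sum_mono weighted_am_gm) auto
  also have "(\<Sum>i\<in>A. t * (f i / F) + (1 - t) * (g i / G)) = t * (F / F) + (1 - t) * (G / G)"
    by (simp add: sum.distrib flip: F_def G_def sum_distrib_left sum_divide_distrib)
  also have "\<dots> = 1"
    using pos by simp
  finally show ?thesis
    by (simp add: F_def G_def)
next
  case False
  then consider "infinite A" | "finite A" "\<forall>i\<in>A. f i = 0" | "finite A" "\<forall>i\<in>A. g i = 0"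
    using f g by (auto simp: sum_nonneg_eq_0_iff)
  then show ?thesis
    by cases auto
qed

text \<open>Boundedness of a matrix as a bilinear form on \<open>\<ell>\<^sub>p \<times> \<ell>\<^sub>q\<close> with \<open>\<alpha> = 1/p\<close>, \<open>\<beta> = 1/q\<close>.
  Writing \<open>|x\<^sub>j| \<le> w\<^sub>j\<^sup>\<alpha>\<close> makes \<open>(\<Sum>w)\<^sup>\<alpha>\<close> play the role of the norm and covers \<open>\<alpha> = 0\<close>
  (the space \<open>c\<^sub>0\<close>) uniformly.\<close>

definition matrix_form_bound ::
  "'i set \<Rightarrow> 'l set \<Rightarrow> real \<Rightarrow> real \<Rightarrow> ('i \<Rightarrow> 'l \<Rightarrow> 'k::real_normed_field) \<Rightarrow> real \<Rightarrow> bool" where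
  "matrix_form_bound J K \<alpha> \<beta> a M \<longleftrightarrow>
     (\<forall>x y w v. (\<forall>j\<in>J. 0 \<le> w j \<and> norm (x j) \<le> w j powr \<alpha>) \<longrightarrow>
                (\<forall>k\<in>K. 0 \<le> v k \<and> norm (y k) \<le> v k powr \<beta>) \<longrightarrow>
        norm (\<Sum>j\<in>J. \<Sum>k\<in>K. x j * y k * a j k) \<le> M * (\<Sum>j\<in>J. w j) powr \<alpha> * (\<Sum>k\<in>K. v k) powr \<beta>)"

lemma matrix_form_boundD:
  assumes "matrix_form_bound J K \<alpha> \<beta> a M"
    and "\<And>j. j \<in> J \<Longrightarrow> 0 \<le> w j" "\<And>j. j \<in> J \<Longrightarrow> norm (x j) \<le> w j powr \<alpha>"
    and "\<And>k. k \<in> K \<Longrightarrow> 0 \<le> v k" "\<And>k. k \<in> K \<Longrightarrow> norm (y k) \<le> v k powr \<beta>"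
  shows "norm (\<Sum>j\<in>J. \<Sum>k\<in>K. x j * y k * a j k) \<le> M * (\<Sum>j\<in>J. w j) powr \<alpha> * (\<Sum>k\<in>K. v k) powr \<beta>"
  using assms unfolding matrix_form_bound_def by blast

text \<open>Allows the random signs to be placed on the other index as well.\<close>

lemma matrix_form_bound_transpose:
  fixes a :: "'i \<Rightarrow> 'l \<Rightarrow> 'k::real_normed_field"
  assumes "matrix_form_bound J K \<alpha> \<beta> a M"
  shows "matrix_form_bound K J \<beta> \<alpha> (\<lambda>k j. a j k) M"
  unfolding matrix_form_bound_def
proof (intro allI impI)
  fix y :: "'l \<Rightarrow> 'k" and x :: "'i \<Rightarrow> 'k" and v w
  assume "\<forall>k\<in>K. 0 \<le> v k \<and> norm (y k) \<le> v k powr \<beta>" "\<forall>j\<in>J. 0 \<le> w j \<and> norm (x j) \<le> w j powr \<alpha>"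
  then have "norm (\<Sum>j\<in>J. \<Sum>k\<in>K. x j * y k * a j k) \<le> M * (\<Sum>j\<in>J. w j) powr \<alpha> * (\<Sum>k\<in>K. v k) powr \<beta>"
    by (intro matrix_form_boundD[OF assms]) auto
  also have "(\<Sum>j\<in>J. \<Sum>k\<in>K. x j * y k * a j k) = (\<Sum>k\<in>K. \<Sum>j\<in>J. y k * x j * a j k)"
    by (subst sum.swap) (simp add: mult.commute)
  finally show "norm (\<Sum>k\<in>K. \<Sum>j\<in>J. y k * x j * a j k)
      \<le> M * (\<Sum>k\<in>K. v k) powr \<beta> * (\<Sum>j\<in>J. w j) powr \<alpha>"
    by (simp add: mult_ac)
qed

text \<open>For every choice of signs the form is tested on the signed weights in one variable and
  on matching phases in the other, which turns the bound on the form into a weighted sum of absolute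
  values. Averaging over the signs and applying Khinchin for each k produces the square
  functions.\<close>

lemma matrix_form_bound_l1_l2:
  fixes a :: "'i \<Rightarrow> 'l \<Rightarrow> 'k::{real_normed_field,real_inner}"
  assumes a: "matrix_form_bound J K \<alpha> \<beta> a M" and J: "finite J"
    and w: "\<And>j. j \<in> J \<Longrightarrow> 0 \<le> w j" and v: "\<And>k. k \<in> K \<Longrightarrow> 0 \<le> v k"
  shows "(\<Sum>k\<in>K. v k powr \<beta> * sqrt (\<Sum>j\<in>J. (w j powr \<alpha> * norm (a j k))\<^sup>2))
           \<le> 9 / 5 * M * (\<Sum>j\<in>J. w j) powr \<alpha> * (\<Sum>k\<in>K. v k) powr \<beta>"
proof -
  define R where "R = M * (\<Sum>j\<in>J. w j) powr \<alpha> * (\<Sum>k\<in>K. v k) powr \<beta>"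
  define z where "z S k = (\<Sum>j\<in>J. rademacher S j *\<^sub>R (w j powr \<alpha> *\<^sub>R a j k))" for S k
  have bound: "(\<Sum>k\<in>K. v k powr \<beta> * norm (z S k)) \<le> R" for S
  proof -
    define x :: "'i \<Rightarrow> 'k" where "x j = of_real (rademacher S j * w j powr \<alpha>)" for j
    \<comment> \<open>The factor |z|/z aligns the phases for real and complex scalars alike. Where z
      = 0 the quotient is 0, which is harmless.\<close>
    define y where "y k = of_real (v k powr \<beta>) * (of_real (norm (z S k)) / z S k)" for k
    have "(\<Sum>j\<in>J. \<Sum>k\<in>K. x j * y k * a j k) = (\<Sum>k\<in>K. y k * z S k)"
      by (subst sum.swap)
        (simp add: x_def z_def sum_distrib_left scaleR_conv_of_real mult_ac)
    also have "\<dots> = of_real (\<Sum>k\<in>K. v k powr \<beta> * norm (z S k))"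
      by (auto simp: y_def intro!: sum.cong)
    finally have "\<bar>\<Sum>k\<in>K. v k powr \<beta> * norm (z S k)\<bar> = norm (\<Sum>j\<in>J. \<Sum>k\<in>K. x j * y k * a j k)"
      by (simp only: norm_of_real)
    also have "\<dots> \<le> R"
      unfolding R_def using w v
      by (intro matrix_form_boundD[OF a])
        (auto simp: x_def y_def norm_mult norm_divide abs_mult)
    finally show ?thesis by simp
  qed
  have "2 ^ card J * (\<Sum>k\<in>K. v k powr \<beta> * sqrt (\<Sum>j\<in>J. (w j powr \<alpha> * norm (a j k))\<^sup>2))
      = (\<Sum>k\<in>K. v k powr \<beta> * (2 ^ card J * sqrt (\<Sum>j\<in>J. (norm (w j powr \<alpha> *\<^sub>R a j k))\<^sup>2)))"
    by (simp add: sum_distrib_left mult_ac)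
  also have "\<dots> \<le> (\<Sum>k\<in>K. v k powr \<beta> * (9 / 5 * (\<Sum>S\<in>Pow J. norm (z S k))))"
    unfolding z_def by (intro sum_mono mult_left_mono khinchin_L1 J) auto
  also have "\<dots> = 9 / 5 * (\<Sum>S\<in>Pow J. \<Sum>k\<in>K. v k powr \<beta> * norm (z S k))"
    by (subst sum.swap) (simp add: sum_distrib_left sum_divide_distrib mult_ac)
  also have "\<dots> \<le> 9 / 5 * (\<Sum>S\<in>Pow J. R)"
    by (intro mult_left_mono sum_mono bound) auto
  also have "\<dots> = 2 ^ card J * (9 / 5 * R)"
    using J by (simp add: card_Pow)
  finally show ?thesis
    by (simp add: R_def)
qed

text \<open>The endpoints explain the shape: for u = 1 the bound is \<open>l1_l2\<close> with
  constant weights, and for u = 2 it is the sum of all squares, which \<open>dual\<close> controls.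
  In between, \<open>F\<close> carries the information of the first and \<open>G\<close> that of the
  second.\<close>

lemma mixed_sum_interpolation:
  fixes d :: "'i \<Rightarrow> 'l \<Rightarrow> real"
  assumes u: "1 \<le> u" "u \<le> 2" and \<alpha>: "\<alpha> = 1 - 1 / u" and Q: "0 \<le> Q"
    and fin: "finite J" "finite K" and d: "\<And>j k. 0 \<le> d j k"
    and l1_l2: "\<And>w. (\<And>j. 0 \<le> w j) \<Longrightarrow>
      (\<Sum>k\<in>K. sqrt (\<Sum>j\<in>J. (w j powr \<alpha> * d j k)\<^sup>2)) \<le> Q * (\<Sum>j\<in>J. w j) powr \<alpha>"
    and dual: "\<And>w. (\<And>j. 0 \<le> w j) \<Longrightarrow>
      (\<Sum>j\<in>J. w j powr \<alpha> * sqrt (\<Sum>k\<in>K. (d j k)\<^sup>2)) \<le> Q * (\<Sum>j\<in>J. w j) powr \<alpha>"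
  shows "(\<Sum>k\<in>K. sqrt (\<Sum>j\<in>J. (d j k)\<^sup>2) powr u) \<le> Q powr u"
proof -
  define c where "c j = sqrt (\<Sum>k\<in>K. (d j k)\<^sup>2)" for j
  define w where "w j = c j powr u" for j
  define W where "W = (\<Sum>j\<in>J. w j)"
  define F where "F k = (\<Sum>j\<in>J. (w j powr \<alpha> * d j k)\<^sup>2)" for k
  define G where "G k = (\<Sum>j\<in>J. c j powr (u - 2) * (d j k)\<^sup>2)" for k
  define \<theta> where "\<theta> = (2 - u) / u"
  have c0: "0 \<le> c j" for j
    by (simp add: c_def sum_nonneg)
  have w\<alpha>: "w j powr \<alpha> = c j powr (u - 1)" for j
    using u by (simp add: w_def powr_powr \<alpha> algebra_simps)
  have nonneg: "0 \<le> W" "0 \<le> F k" "0 \<le> G k" for k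
    by (auto simp: W_def F_def G_def w_def intro!: sum_nonneg)
  have \<theta>: "0 \<le> \<theta>" "\<theta> \<le> 1"
    using u by (auto simp: \<theta>_def field_simps)

  \<comment> \<open>The weights c^u are extremal in the duality: \<open>dual\<close> reads W \<le> Q
    W^\<alpha>, and 1 - \<alpha> = 1/u.\<close>
  have W_le: "W \<le> Q powr u"
  proof (cases "W = 0")
    case False
    with nonneg have W: "W > 0" by simp
    have "W = (\<Sum>j\<in>J. w j powr \<alpha> * c j)"
      unfolding W_def
    proof (rule sum.cong)
      fix j
      show "w j = w j powr \<alpha> * c j"
        unfolding w\<alpha> using powr_mult_base[OF c0, of j "u - 1"] by (simp add: w_def mult.commute)
    qed simp
    also have "\<dots> \<le> Q * W powr \<alpha>"
      unfolding c_def W_def by (rule dual) (simp add: w_def)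
    finally have "W powr (1 - \<alpha>) \<le> Q"
      using W by (simp add: powr_diff divide_simps)
    then have "(W powr (1 - \<alpha>)) powr u \<le> Q powr u"
      using u by (intro powr_mono2) auto
    then show ?thesis
      using W u by (simp add: powr_powr \<alpha>)
  qed simp

  have sum_F: "(\<Sum>k\<in>K. sqrt (F k)) \<le> Q * W powr \<alpha>"
    unfolding F_def W_def by (rule l1_l2) (simp add: w_def)
  \<comment> \<open>Exchanging the sums recovers (c j)^2 from the inner sum over k.\<close>
  have "(\<Sum>k\<in>K. G k) = (\<Sum>j\<in>J. c j powr (u - 2) * (c j)\<^sup>2)"
    unfolding G_def c_def
    by (subst sum.swap) (simp add: sum_distrib_left sum_nonneg)
  also have "\<dots> = W"
    unfolding W_def
  proof (rule sum.cong)
    fix j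
    have "c j powr (u - 2) * c j powr 2 = w j"
      by (simp only: powr_add[symmetric] w_def) simp
    then show "c j powr (u - 2) * (c j)\<^sup>2 = w j"
      using c0[of j] by simp
  qed simp
  finally have sum_G: "(\<Sum>k\<in>K. G k) = W" .

  have b_le: "sqrt (\<Sum>j\<in>J. (d j k)\<^sup>2) powr u \<le> sqrt (F k) powr (2 - u) * G k powr (1 - (2 - u))"
    if k: "k \<in> K" for k
  proof -
    \<comment> \<open>\<theta> is chosen so that the powers of \<open>c j\<close> cancel: 2 (u - 1)
      \<theta> + (u - 2) (1 - \<theta>) = 0. This requires c j > 0, which follows from d j k > 0
      because k lies in \<open>K\<close>.\<close>
    have split: "(d j k)\<^sup>2 = ((w j powr \<alpha> * d j k)\<^sup>2) powr \<theta> * (c j powr (u - 2) * (d j k)\<^sup>2) powr (1 - \<theta>)"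
      (is "_ = ?rhs") for j
    proof (cases "d j k = 0")
      case False
      with d[of j k] have dpos: "d j k > 0" by simp
      have "(d j k)\<^sup>2 \<le> (\<Sum>k\<in>K. (d j k)\<^sup>2)"
        using fin k by (intro member_le_sum) auto
      moreover have "(d j k)\<^sup>2 > 0"
        using dpos by simp
      ultimately have cpos: "c j > 0"
        unfolding c_def real_sqrt_gt_0_iff by linarith
      have "?rhs = c j powr (2 * (u - 1) * \<theta>) * c j powr ((u - 2) * (1 - \<theta>))
                   * (d j k powr (2 * \<theta>) * d j k powr (2 * (1 - \<theta>)))"
        unfolding w\<alpha> using dpos cpos
        by (simp add: powr_mult powr_powr power_mult_distrib mult_ac flip: powr_numeral)
      also have "d j k powr (2 * \<theta>) * d j k powr (2 * (1 - \<theta>)) = (d j k)\<^sup>2"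
        using dpos by (simp add: algebra_simps flip: powr_add)
      also have "2 * (u - 1) * \<theta> + (u - 2) * (1 - \<theta>) = 0"
        using u by (simp add: \<theta>_def field_simps)
      then have "c j powr (2 * (u - 1) * \<theta>) * c j powr ((u - 2) * (1 - \<theta>)) = 1"
        using cpos by (simp flip: powr_add)
      finally show ?thesis by simp
    qed simp
    have "(\<Sum>j\<in>J. (d j k)\<^sup>2) \<le> F k powr \<theta> * G k powr (1 - \<theta>)"
      unfolding F_def G_def by (subst split, rule holder_sum) (use \<theta> in auto)
    then have "(\<Sum>j\<in>J. (d j k)\<^sup>2) powr (u / 2) \<le> (F k powr \<theta> * G k powr (1 - \<theta>)) powr (u / 2)"
      using u by (intro powr_mono2) (auto simp: sum_nonneg)
    also have "\<dots> = F k powr (\<theta> * (u / 2)) * G k powr ((1 - \<theta>) * (u / 2))"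
      by (simp add: powr_mult powr_powr)
    also have "\<theta> * (u / 2) = 1 / 2 * (2 - u)"
      using u by (simp add: \<theta>_def)
    also have "(1 - \<theta>) * (u / 2) = 1 - (2 - u)"
      using u by (simp add: \<theta>_def field_simps)
    finally show ?thesis
      using nonneg by (simp add: powr_powr sum_nonneg flip: powr_half_sqrt)
  qed

  have "(\<Sum>k\<in>K. sqrt (\<Sum>j\<in>J. (d j k)\<^sup>2) powr u)
      \<le> (\<Sum>k\<in>K. sqrt (F k) powr (2 - u) * G k powr (1 - (2 - u)))"
    by (intro sum_mono b_le)
  \<comment> \<open>A second use of Hoelder, now over k, with exponents 2 - u and u - 1. The latter
    is kept in the form 1 - (2 - u) to fit \<open>holder_sum\<close>.\<close>
  also have "\<dots> \<le> (\<Sum>k\<in>K. sqrt (F k)) powr (2 - u) * (\<Sum>k\<in>K. G k) powr (1 - (2 - u))"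
    using u nonneg by (intro holder_sum) auto
  also have "\<dots> \<le> (Q * W powr \<alpha>) powr (2 - u) * W powr (1 - (2 - u))"
    unfolding sum_G using u nonneg sum_F
    by (intro mult_right_mono powr_mono2) (auto intro!: sum_nonneg)
  also have "\<dots> = Q powr (2 - u) * W powr (\<alpha> * (2 - u) + (1 - (2 - u)))"
    by (simp add: powr_mult powr_powr powr_add)
  also have "\<alpha> * (2 - u) + (1 - (2 - u)) = 2 * \<alpha>"
    using u by (simp add: \<alpha> field_simps)
  also have "Q powr (2 - u) * W powr (2 * \<alpha>) \<le> Q powr (2 - u) * (Q powr u) powr (2 * \<alpha>)"
    using W_le nonneg u by (intro mult_left_mono powr_mono2) (auto simp: \<alpha> field_simps)
  also have "\<dots> = Q powr (2 - u + u * (2 * \<alpha>))"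
    by (simp add: powr_powr powr_add)
  also have "2 - u + u * (2 * \<alpha>) = u"
    using u by (simp add: \<alpha> field_simps)
  finally show ?thesis .
qed

text \<open>Scaling column k by v k^\<beta> absorbs the second variable and leaves the case \<beta>
  = 0, at the cost of a factor V^\<beta> in the constant. For the extremal v this factor can be
  divided out again.\<close>

lemma matrix_form_bound_mixed:
  fixes a :: "'i \<Rightarrow> 'l \<Rightarrow> 'k::{real_normed_field,real_inner}"
  assumes a: "matrix_form_bound J K \<alpha> \<beta> a M" and fin: "finite J" "finite K" and M: "0 \<le> M"
    and \<alpha>: "0 \<le> \<alpha>" "\<alpha> \<le> 1 / 2" and \<beta>: "0 \<le> \<beta>" "\<alpha> + \<beta> < 1"
    and l: "l = 1 / (1 - \<alpha> - \<beta>)"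
  shows "(\<Sum>k\<in>K. (\<Sum>j\<in>J. (norm (a j k))\<^sup>2) powr (l / 2)) powr (1 / l) \<le> 9 / 5 * M"
proof -
  define u where "u = 1 / (1 - \<alpha>)"
  define b where "b k = sqrt (\<Sum>j\<in>J. (norm (a j k))\<^sup>2)" for k
  \<comment> \<open>With this v the scaled column has norm b^(1 + l \<beta>), and (1 + l \<beta>) u
    = l, so that its u-th power is v itself and the scaled sum is \<open>V\<close>.\<close>
  define v where "v k = b k powr l" for k
  define V where "V = (\<Sum>k\<in>K. v k)"
  define Q where "Q = 9 / 5 * M * V powr \<beta>"
  define d where "d j k = v k powr \<beta> * norm (a j k)" for j k
  have u: "1 \<le> u" "u \<le> 2" "\<alpha> = 1 - 1 / u"
    using \<alpha> by (auto simp: u_def field_simps)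
  have lpos: "l > 0"
    using \<beta> l by simp
  have b0: "0 \<le> b k" and v0: "0 \<le> v k" for k
    by (auto simp: b_def v_def sum_nonneg)
  have V0: "0 \<le> V"
    using v0 by (simp add: V_def sum_nonneg)
  have factor: "sqrt (\<Sum>i\<in>I. (t * f i)\<^sup>2) = t * sqrt (\<Sum>i\<in>I. (f i)\<^sup>2)" if "0 \<le> t"
    for t and f :: "'x \<Rightarrow> real" and I
    using that by (simp add: power_mult_distrib real_sqrt_mult flip: sum_distrib_left)
  have "(\<Sum>k\<in>K. sqrt (\<Sum>j\<in>J. (d j k)\<^sup>2) powr u) \<le> Q powr u"
  proof (rule mixed_sum_interpolation[OF u])
    fix w :: "'i \<Rightarrow> real"
    assume w: "\<And>j. 0 \<le> w j"
    have "(\<Sum>k\<in>K. sqrt (\<Sum>j\<in>J. (w j powr \<alpha> * d j k)\<^sup>2))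
        = (\<Sum>k\<in>K. v k powr \<beta> * sqrt (\<Sum>j\<in>J. (w j powr \<alpha> * norm (a j k))\<^sup>2))"
      by (subst factor[symmetric]) (auto simp: d_def mult_ac)
    also have "\<dots> \<le> 9 / 5 * M * (\<Sum>j\<in>J. w j) powr \<alpha> * (\<Sum>k\<in>K. v k) powr \<beta>"
      using matrix_form_bound_l1_l2[OF a] fin w v0 by blast
    finally show "(\<Sum>k\<in>K. sqrt (\<Sum>j\<in>J. (w j powr \<alpha> * d j k)\<^sup>2)) \<le> Q * (\<Sum>j\<in>J. w j) powr \<alpha>"
      by (simp add: Q_def V_def mult_ac)
    have "(\<Sum>j\<in>J. w j powr \<alpha> * sqrt (\<Sum>k\<in>K. (d j k)\<^sup>2))
        \<le> 9 / 5 * M * (\<Sum>k\<in>K. v k) powr \<beta> * (\<Sum>j\<in>J. w j) powr \<alpha>"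
      unfolding d_def
      using matrix_form_bound_l1_l2[OF matrix_form_bound_transpose[OF a]] fin w v0 by blast
    then show "(\<Sum>j\<in>J. w j powr \<alpha> * sqrt (\<Sum>k\<in>K. (d j k)\<^sup>2)) \<le> Q * (\<Sum>j\<in>J. w j) powr \<alpha>"
      by (simp add: Q_def V_def)
  qed (use fin M in \<open>auto simp: Q_def d_def\<close>)
  moreover have "sqrt (\<Sum>j\<in>J. (d j k)\<^sup>2) powr u = v k" for k
  proof -
    have "sqrt (\<Sum>j\<in>J. (d j k)\<^sup>2) = b k powr (1 + l * \<beta>)"
      unfolding d_def using b0[of k]
      by (subst factor) (auto simp: v_def powr_powr b_def powr_mult_base[symmetric] sum_nonneg mult.commute)
    moreover have "(1 + l * \<beta>) * u = l"
      using \<alpha> \<beta> by (simp add: u_def l divide_simps)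
    ultimately show ?thesis
      by (simp add: powr_powr v_def)
  qed
  ultimately have V_le: "V \<le> Q powr u"
    by (simp add: V_def)
  have "V powr (1 / l) \<le> 9 / 5 * M"
  proof (cases "V = 0")
    case True
    then show ?thesis using M by simp
  next
    case False
    with V0 have V: "V > 0" by simp
    have "V powr (1 / u) \<le> (Q powr u) powr (1 / u)"
      using V_le V u by (intro powr_mono2) auto
    also have "\<dots> = Q"
      using u M by (simp add: powr_powr Q_def)
    \<comment> \<open>The factor V^\<beta> contained in \<open>Q\<close> is moved to the left; the
      remaining exponent is 1/u - \<beta> = 1/l.\<close>
    finally have "V powr (1 / u - \<beta>) \<le> 9 / 5 * M"
      using V by (simp add: Q_def powr_diff pos_divide_le_eq)
    moreover have "1 / u - \<beta> = 1 / l"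
      using \<alpha> \<beta> by (simp add: u_def l)
    ultimately show ?thesis by simp
  qed
  moreover have "v k = (\<Sum>j\<in>J. (norm (a j k))\<^sup>2) powr (l / 2)" for k
    by (simp add: v_def b_def powr_powr sum_nonneg flip: powr_half_sqrt)
  ultimately show ?thesis
    by (simp add: V_def)
qed

subsection \<open>Bilinear forms on sequence spaces\<close>

lemma ereal_ge_2_cases:
  fixes p :: ereal
  assumes "2 \<le> p"
  obtains "p = \<infinity>" | r where "p = ereal r" "2 \<le> r"
  using assms by (cases p) auto

lemma inv_exp_bounds:
  assumes "2 \<le> p"
  shows "0 \<le> inv_exp p" "inv_exp p \<le> 1 / 2"
  using assms by (cases rule: ereal_ge_2_cases; simp add: inv_exp_def field_simps)+

section \<open>Unit balls of the sequence spaces described by weights\<close>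

lemma X_space_finite_support:
  assumes p: "2 \<le> p" and "finite I" "\<And>n. n \<notin> I \<Longrightarrow> x n = 0"
  shows "x \<in> X_space p"
proof -
  obtain N where N: "I \<subseteq> {..<N}"
    using \<open>finite I\<close> finite_nat_iff_bounded by blast
  have "eventually (\<lambda>n. x n = 0) sequentially"
    using N assms(3) by (intro eventually_sequentiallyI[of N]) (metis lessThan_iff not_le subsetD)
  then have "x \<longlonglongrightarrow> 0"
    by (rule tendsto_eventually)
  moreover have "summable (\<lambda>n. norm (x n) powr r)" for r
    using assms by (intro summable_finite[of I]) auto
  ultimately show ?thesis
    by (simp add: X_space_def)
qed

lemma unit_vec_in_X_space: "2 \<le> p \<Longrightarrow> unit_vec j \<in> X_space p"
  by (rule X_space_finite_support[of _ "{j}"]) (auto simp: unit_vec_def)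

lemma zero_in_X_space: "2 \<le> p \<Longrightarrow> (\<lambda>_. 0) \<in> X_space p"
  by (rule X_space_finite_support[of _ "{}"]) auto

lemma norm_le_X_norm:
  assumes p: "2 \<le> p" and x: "x \<in> X_space p"
  shows "norm (x n) \<le> X_norm p x"
  using p
proof (cases rule: ereal_ge_2_cases)
  case 1
  then have "x \<longlonglongrightarrow> 0"
    using x by (simp add: X_space_def)
  then have "Bseq x"
    by (intro convergent_imp_Bseq convergentI)
  then have "bdd_above (range (\<lambda>n. norm (x n)))"
    by (auto simp: Bseq_def bdd_above_def)
  then show ?thesis
    using 1 by (auto simp: X_norm_def intro: cSUP_upper)
next
  case (2 r)
  then have "summable (\<lambda>n. norm (x n) powr r)"
    using x by (simp add: X_space_def)
  then have "(\<Sum>i\<in>{n}. norm (x i) powr r) \<le> (\<Sum>n. norm (x n) powr r)"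
    by (rule sum_le_suminf) auto
  then have "(norm (x n) powr r) powr (1 / r) \<le> (\<Sum>n. norm (x n) powr r) powr (1 / r)"
    using 2 by (intro powr_mono2) auto
  then show ?thesis
    using 2 by (simp add: X_norm_def powr_powr)
qed

lemma X_norm_nonneg: "2 \<le> p \<Longrightarrow> x \<in> X_space p \<Longrightarrow> 0 \<le> X_norm p x"
  using norm_le_X_norm[of p x 0] norm_ge_zero order_trans by blast

text \<open>Together with the converse \<open>X_norm_le_1_weights\<close>, this translates between
  the norm and weights of total mass at most 1, so that later estimates need not separate finite p
  from p = \<infinity>.\<close>

lemma X_norm_le_1I:
  assumes p: "2 \<le> p" and I: "finite I" "\<And>n. n \<notin> I \<Longrightarrow> x n = 0"
    and w: "\<And>n. n \<in> I \<Longrightarrow> 0 \<le> w n" "\<And>n. n \<in> I \<Longrightarrow> norm (x n) \<le> w n powr inv_exp p"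
      "(\<Sum>n\<in>I. w n) \<le> 1"
  shows "X_norm p x \<le> 1"
  using p
proof (cases rule: ereal_ge_2_cases)
  case 1
  have "norm (x n) \<le> 1" for n
    using w(2)[of n] I(2)[of n] 1 by (cases "n \<in> I") (auto simp: inv_exp_def split: if_splits)
  then show ?thesis
    using 1 by (auto simp: X_norm_def intro: cSUP_least)
next
  case (2 r)
  have "(\<Sum>n. norm (x n) powr r) = (\<Sum>n\<in>I. norm (x n) powr r)"
    using I by (intro suminf_finite) auto
  also have "\<dots> \<le> (\<Sum>n\<in>I. w n)"
  proof (rule sum_mono)
    fix n assume n: "n \<in> I"
    have "norm (x n) powr r \<le> (w n powr (1 / r)) powr r"
      using w(2)[OF n] 2 by (intro powr_mono2) (auto simp: inv_exp_def)
    then show "norm (x n) powr r \<le> w n"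
      using 2 w(1)[OF n] by (simp add: powr_powr)
  qed
  also note w(3)
  finally have "(\<Sum>n. norm (x n) powr r) \<le> 1" .
  moreover have "0 \<le> (\<Sum>n. norm (x n) powr r)"
    using X_space_finite_support[OF p I] 2 by (intro suminf_nonneg) (auto simp: X_space_def)
  ultimately show ?thesis
    using 2 by (auto simp: X_norm_def intro!: powr_le1)
qed

lemma X_norm_le_1_weights:
  assumes p: "2 \<le> p" and x: "x \<in> X_space p" "X_norm p x \<le> 1"
  obtains w :: "nat \<Rightarrow> real" where "\<And>j. 0 \<le> w j" "\<And>j. j < n \<Longrightarrow> norm (x j) \<le> w j powr inv_exp p"
    "(\<Sum>j<n. w j) \<le> 1"
  using p
proof (cases rule: ereal_ge_2_cases)
  case 1
  \<comment> \<open>The exponent is 0, so every positive weight bounds the coordinates by 1; the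
    uniform choice keeps the total mass at most 1.\<close>
  show ?thesis
  proof (rule that[of "\<lambda>_. 1 / real n"])
    fix j assume "j < n"
    then show "norm (x j) \<le> (1 / real n) powr inv_exp p"
      using 1 norm_le_X_norm[OF p x(1), of j] x(2) by (simp add: inv_exp_def)
  qed auto
next
  case (2 r)
  have s: "summable (\<lambda>n. norm (x n) powr r)"
    using x 2 by (simp add: X_space_def)
  have nn: "0 \<le> (\<Sum>n. norm (x n) powr r)"
    by (intro suminf_nonneg s) auto
  show ?thesis
  proof (rule that[of "\<lambda>j. norm (x j) powr r"])
    fix j
    show "norm (x j) \<le> (norm (x j) powr r) powr inv_exp p"
      using 2 by (simp add: inv_exp_def powr_powr)
  next
    have "((\<Sum>n. norm (x n) powr r) powr (1 / r)) powr r \<le> 1 powr r"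
      using x(2) 2 by (intro powr_mono2) (auto simp: X_norm_def)
    then have "(\<Sum>n. norm (x n) powr r) \<le> 1"
      using 2 nn by (simp add: powr_powr)
    moreover have "(\<Sum>j<n. norm (x j) powr r) \<le> (\<Sum>n. norm (x n) powr r)"
      by (rule sum_le_suminf[OF s]) auto
    ultimately show "(\<Sum>j<n. norm (x j) powr r) \<le> 1"
      by simp
  qed auto
qed

text \<open>A value is below the supremum only once the set is known to be bounded above; continuity
  provides this. The absolute value of M is taken since its sign is not prescribed.\<close>

lemma bil_norm_upper:
  assumes pq: "2 \<le> p" "2 \<le> q" and A: "cont_bilinear_form p q A"
    and x: "x \<in> X_space p" "X_norm p x \<le> 1" and y: "y \<in> X_space q" "X_norm q y \<le> 1"
  shows "norm (A x y) \<le> bil_norm p q A"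
proof -
  obtain M where M: "\<And>x y. x \<in> X_space p \<Longrightarrow> y \<in> X_space q \<Longrightarrow> norm (A x y) \<le> M * X_norm p x * X_norm q y"
    using A unfolding cont_bilinear_form_def by blast
  have "norm (A x y) \<le> \<bar>M\<bar>"
    if "x \<in> X_space p" "X_norm p x \<le> 1" "y \<in> X_space q" "X_norm q y \<le> 1" for x y
  proof -
    have nn: "0 \<le> X_norm p x" "0 \<le> X_norm q y"
      using X_norm_nonneg pq that by auto
    have "norm (A x y) \<le> M * (X_norm p x * X_norm q y)"
      using M[of x y] that by (simp add: mult.assoc)
    also have "\<dots> \<le> \<bar>M\<bar> * (X_norm p x * X_norm q y)"
      using nn by (intro mult_right_mono) auto
    also have "\<dots> \<le> \<bar>M\<bar> * (1 * 1)"
      using nn that by (intro mult_left_mono mult_mono) auto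
    finally show ?thesis by simp
  qed
  then have "bdd_above {norm (A x y) | x y. x \<in> X_space p \<and> y \<in> X_space q \<and> X_norm p x \<le> 1 \<and> X_norm q y \<le> 1}"
    by (intro bdd_aboveI[of _ "\<bar>M\<bar>"]) auto
  then show ?thesis
    unfolding bil_norm_def using x y by (intro cSup_upper) auto
qed

lemma X_norm_zero_le_1: "2 \<le> p \<Longrightarrow> X_norm p (\<lambda>_. 0) \<le> 1"
  by (rule X_norm_le_1I[of _ "{}" _ "\<lambda>_. 0"]) auto

lemma bil_norm_nonneg:
  assumes "2 \<le> p" "2 \<le> q" "cont_bilinear_form p q A"
  shows "0 \<le> bil_norm p q A"
  using bil_norm_upper[OF assms zero_in_X_space X_norm_zero_le_1 zero_in_X_space X_norm_zero_le_1] assms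
    norm_ge_zero order_trans by blast

lemma bil_norm_leI:
  assumes "2 \<le> p" "2 \<le> q"
    and "\<And>x y. \<lbrakk>x \<in> X_space p; X_norm p x \<le> 1; y \<in> X_space q; X_norm q y \<le> 1\<rbrakk> \<Longrightarrow> norm (A x y) \<le> B"
  shows "bil_norm p q A \<le> B"
  unfolding bil_norm_def
proof (rule cSup_least)
  show "{norm (A x y) | x y. x \<in> X_space p \<and> y \<in> X_space q \<and> X_norm p x \<le> 1 \<and> X_norm q y \<le> 1} \<noteq> {}"
    using zero_in_X_space X_norm_zero_le_1 assms(1,2) by blast
qed (use assms(3) in auto)

lemma linear_finite_support:
  fixes L :: "(nat \<Rightarrow> 'k::real_normed_field) \<Rightarrow> 'k"
  assumes p: "2 \<le> p"
    and L: "\<And>x x' c d. x \<in> X_space p \<Longrightarrow> x' \<in> X_space p \<Longrightarrow> L (\<lambda>n. c * x n + d * x' n) = c * L x + d * L x'"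
    and "finite J"
  shows "L (\<lambda>n. if n \<in> J then x n else 0) = (\<Sum>j\<in>J. x j * L (unit_vec j))"
  using \<open>finite J\<close>
proof (induction J rule: finite_induct)
  case empty
  \<comment> \<open>Linearity with both coefficients 0 yields L 0 = 0.\<close>
  show ?case
    using L[OF zero_in_X_space zero_in_X_space, of 0 0] p by simp
next
  case (insert i J)
  have "(\<lambda>n. if n \<in> insert i J then x n else 0) = (\<lambda>n. x i * unit_vec i n + 1 * (if n \<in> J then x n else 0))"
    using insert.hyps by (auto simp: unit_vec_def)
  moreover have "(\<lambda>n. if n \<in> J then x n else 0) \<in> X_space p"
    using insert.hyps by (intro X_space_finite_support[OF p, of J]) auto
  ultimately show ?case
    using L[OF unit_vec_in_X_space[OF p], of "\<lambda>n. if n \<in> J then x n else 0" "x i" i 1] insert by simp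
qed

lemma bilinear_finite_support:
  assumes pq: "2 \<le> p" "2 \<le> q" and A: "cont_bilinear_form p q A" and fin: "finite J" "finite K"
  shows "A (\<lambda>n. if n \<in> J then x n else 0) (\<lambda>n. if n \<in> K then y n else 0)
           = (\<Sum>j\<in>J. \<Sum>k\<in>K. x j * y k * A (unit_vec j) (unit_vec k))"
proof -
  have y: "(\<lambda>n. if n \<in> K then y n else 0) \<in> X_space q"
    using fin by (intro X_space_finite_support[OF pq(2), of K]) auto
  have "A (\<lambda>n. if n \<in> J then x n else 0) (\<lambda>n. if n \<in> K then y n else 0)
      = (\<Sum>j\<in>J. x j * A (unit_vec j) (\<lambda>n. if n \<in> K then y n else 0))"
    using A y fin
    by (intro linear_finite_support[OF pq(1), of "\<lambda>x. A x (\<lambda>n. if n \<in> K then y n else 0)"])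
      (auto simp: cont_bilinear_form_def)
  also have "\<dots> = (\<Sum>j\<in>J. x j * (\<Sum>k\<in>K. y k * A (unit_vec j) (unit_vec k)))"
    using A fin
    by (intro sum.cong arg_cong2[of _ _ _ _ "(*)"] linear_finite_support[OF pq(2)])
      (auto simp: cont_bilinear_form_def unit_vec_in_X_space[OF pq(1)])
  finally show ?thesis
    by (simp add: sum_distrib_left mult.assoc)
qed

text \<open>By homogeneity: x and y are divided by W^\<alpha> and V^\<beta>, with \<alpha> = 1/p and
  \<beta> = 1/q, and cut off outside \<open>J\<close> and \<open>K\<close>, which places them in the
  unit balls.\<close>

lemma cont_bilinear_form_matrix_form_bound:
  fixes A :: "(nat \<Rightarrow> 'k::real_normed_field) \<Rightarrow> (nat \<Rightarrow> 'k) \<Rightarrow> 'k"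
  assumes pq: "2 \<le> p" "2 \<le> q" and A: "cont_bilinear_form p q A" and fin: "finite J" "finite K"
  shows "matrix_form_bound J K (inv_exp p) (inv_exp q) (\<lambda>j k. A (unit_vec j) (unit_vec k)) (bil_norm p q A)"
  unfolding matrix_form_bound_def
proof (intro allI impI)
  fix x y :: "nat \<Rightarrow> 'k" and w v :: "nat \<Rightarrow> real"
  let ?\<alpha> = "inv_exp p" and ?\<beta> = "inv_exp q"
  let ?a = "\<lambda>j k. A (unit_vec j) (unit_vec k)"
  assume w: "\<forall>j\<in>J. 0 \<le> w j \<and> norm (x j) \<le> w j powr ?\<alpha>"
    and v: "\<forall>k\<in>K. 0 \<le> v k \<and> norm (y k) \<le> v k powr ?\<beta>"
  define W where "W = (\<Sum>j\<in>J. w j)"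
  define V where "V = (\<Sum>k\<in>K. v k)"
  show "norm (\<Sum>j\<in>J. \<Sum>k\<in>K. x j * y k * ?a j k) \<le> bil_norm p q A * (\<Sum>j\<in>J. w j) powr ?\<alpha> * (\<Sum>k\<in>K. v k) powr ?\<beta>"
  proof (cases "W = 0 \<or> V = 0")
    case True
    \<comment> \<open>Zero total mass makes every weight 0, and \<open>0 powr 0 = 0\<close> forces
      the coordinates to vanish even when the exponent is 0.\<close>
    then have "(\<forall>j\<in>J. x j = 0) \<or> (\<forall>k\<in>K. y k = 0)"
      using w v fin by (fastforce simp: W_def V_def sum_nonneg_eq_0_iff)
    then have "(\<Sum>j\<in>J. \<Sum>k\<in>K. x j * y k * ?a j k) = 0"
      by (auto intro!: sum.neutral)
    then show ?thesis
      using bil_norm_nonneg[OF pq A] by simp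
  next
    case False
    moreover have "0 \<le> W" "0 \<le> V"
      unfolding W_def V_def using w v by (auto intro: sum_nonneg)
    ultimately have pos: "W > 0" "V > 0"
      by auto
    define x' where "x' n = (if n \<in> J then of_real (1 / W powr ?\<alpha>) * x n else 0)" for n
    define y' where "y' n = (if n \<in> K then of_real (1 / V powr ?\<beta>) * y n else 0)" for n
    have "X_norm p x' \<le> 1"
    proof (rule X_norm_le_1I[OF pq(1) fin(1), of _ "\<lambda>j. w j / W"])
      show "norm (x' n) \<le> (w n / W) powr ?\<alpha>" if "n \<in> J" for n
        using that w pos by (simp add: x'_def norm_mult norm_divide powr_divide divide_right_mono)
      show "(\<Sum>j\<in>J. w j / W) \<le> 1"
        using pos by (simp add: W_def flip: sum_divide_distrib)
    qed (use w pos in \<open>auto simp: x'_def\<close>)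
    moreover have "X_norm q y' \<le> 1"
    proof (rule X_norm_le_1I[OF pq(2) fin(2), of _ "\<lambda>j. v j / V"])
      show "norm (y' n) \<le> (v n / V) powr ?\<beta>" if "n \<in> K" for n
        using that v pos by (simp add: y'_def norm_mult norm_divide powr_divide divide_right_mono)
      show "(\<Sum>j\<in>K. v j / V) \<le> 1"
        using pos by (simp add: V_def flip: sum_divide_distrib)
    qed (use v pos in \<open>auto simp: y'_def\<close>)
    moreover have "x' \<in> X_space p" "y' \<in> X_space q"
      by (rule X_space_finite_support[OF pq(1) fin(1)], simp add: x'_def)
        (rule X_space_finite_support[OF pq(2) fin(2)], simp add: y'_def)
    ultimately have "norm (A x' y') \<le> bil_norm p q A"
      by (intro bil_norm_upper[OF pq A])
    moreover have "A x' y' = of_real (1 / (W powr ?\<alpha> * V powr ?\<beta>)) * (\<Sum>j\<in>J. \<Sum>k\<in>K. x j * y k * ?a j k)"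
      unfolding x'_def y'_def bilinear_finite_support[OF pq A fin]
      by (simp add: sum_distrib_left mult_ac)
    ultimately show ?thesis
      using pos by (simp add: norm_mult norm_divide divide_simps mult_ac flip: W_def V_def)
  qed
qed

text \<open>The finite estimate is uniform in \<open>J\<close> and \<open>K\<close>, so it survives
  the limit first in j and then in k.\<close>

lemma mixed_le_2_bil_norm:
  fixes A :: "(nat \<Rightarrow> 'k::{real_normed_field,real_inner}) \<Rightarrow> (nat \<Rightarrow> 'k) \<Rightarrow> 'k"
  assumes pq: "2 \<le> p" "2 \<le> q" "inv_exp p + inv_exp q < 1"
    and l: "l = 1 / (1 - inv_exp p - inv_exp q)" and A: "cont_bilinear_form p q A"
  shows "mixed_le 2 l A (9 / 5 * bil_norm p q A)"
proof -
  define B where "B = 9 / 5 * bil_norm p q A"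
  define f where "f j k = (norm (A (unit_vec j) (unit_vec k)))\<^sup>2" for j k
  have f0: "0 \<le> f j k" for j k
    by (simp add: f_def)
  have lpos: "l > 0"
    using l pq by simp
  have B: "0 \<le> B"
    using bil_norm_nonneg[OF pq(1,2) A] by (simp add: B_def)
  have finite_bound: "(\<Sum>k\<in>K. (\<Sum>j\<in>J. f j k) powr (l / 2)) \<le> B powr l" if "finite J" "finite K" for J K
  proof -
    have "(\<Sum>k\<in>K. (\<Sum>j\<in>J. f j k) powr (l / 2)) powr (1 / l) \<le> B"
      unfolding f_def B_def
      by (rule matrix_form_bound_mixed[OF cont_bilinear_form_matrix_form_bound[OF pq(1,2) A that] that])
        (use inv_exp_bounds pq l bil_norm_nonneg[OF pq(1,2) A] in auto)
    then have "((\<Sum>k\<in>K. (\<Sum>j\<in>J. f j k) powr (l / 2)) powr (1 / l)) powr l \<le> B powr l"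
      using lpos by (intro powr_mono2) auto
    then show ?thesis
      using lpos by (simp add: powr_powr sum_nonneg)
  qed
  \<comment> \<open>A single column, K = {k}, bounds the partial sums over j.\<close>
  have summ: "summable (\<lambda>j. f j k)" for k
  proof (rule summableI_nonneg_bounded[where x = "(B powr l) powr (2 / l)"])
    fix n
    have "((\<Sum>j<n. f j k) powr (l / 2)) powr (2 / l) \<le> (B powr l) powr (2 / l)"
      using finite_bound[of "{..<n}" "{k}"] lpos by (intro powr_mono2) auto
    then show "(\<Sum>j<n. f j k) \<le> (B powr l) powr (2 / l)"
      using lpos f0 by (simp add: powr_powr sum_nonneg)
  qed (rule f0)
  have partial: "(\<Sum>k<m. (\<Sum>j. f j k) powr (l / 2)) \<le> B powr l" for m
  proof (rule LIMSEQ_le_const2)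
    show "(\<lambda>n. \<Sum>k<m. (\<Sum>j<n. f j k) powr (l / 2)) \<longlonglongrightarrow> (\<Sum>k<m. (\<Sum>j. f j k) powr (l / 2))"
      using lpos f0
      by (intro tendsto_sum tendsto_powr2 summable_LIMSEQ summ tendsto_const)
        (auto intro!: always_eventually sum_nonneg)
    show "\<exists>N. \<forall>n\<ge>N. (\<Sum>k<m. (\<Sum>j<n. f j k) powr (l / 2)) \<le> B powr l"
      using finite_bound by blast
  qed
  have summ2: "summable (\<lambda>k. (\<Sum>j. f j k) powr (l / 2))"
    by (rule summableI_nonneg_bounded[where x = "B powr l"]) (use partial in auto)
  have "(\<Sum>k. (\<Sum>j. f j k) powr (l / 2)) \<le> B powr l"
    by (rule suminf_le_const[OF summ2 partial])
  then have "(\<Sum>k. (\<Sum>j. f j k) powr (l / 2)) powr (1 / l) \<le> (B powr l) powr (1 / l)"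
    using lpos by (intro powr_mono2 suminf_nonneg summ2) auto
  also have "\<dots> = B"
    using lpos B by (simp add: powr_powr)
  finally show ?thesis
    using summ summ2 unfolding mixed_le_def by (simp add: f_def B_def)
qed

subsection \<open>Optimality of the exponents\<close>

definition matrix_form :: "nat \<Rightarrow> (nat \<Rightarrow> nat \<Rightarrow> 'k::real_normed_field) \<Rightarrow> (nat \<Rightarrow> 'k) \<Rightarrow> (nat \<Rightarrow> 'k) \<Rightarrow> 'k" where
  "matrix_form n a x y = (\<Sum>j<n. \<Sum>k<n. x j * y k * a j k)"

lemma matrix_form_unit_vec:
  "matrix_form n a (unit_vec j) (unit_vec k) = (if j < n \<and> k < n then a j k else 0)"
proof -
  have "matrix_form n a (unit_vec j) (unit_vec k) = (\<Sum>i<n. unit_vec j i * (\<Sum>l<n. unit_vec k l * a i l))"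
    by (simp add: matrix_form_def sum_distrib_left mult.assoc)
  then show ?thesis
    by (simp add: unit_vec_def mult_delta_left)
qed

lemma cont_bilinear_form_matrix_form:
  assumes pq: "2 \<le> p" "2 \<le> q"
  shows "cont_bilinear_form p q (matrix_form n a)"
proof -
  have "norm (matrix_form n a x y) \<le> (\<Sum>j<n. \<Sum>k<n. norm (a j k)) * X_norm p x * X_norm q y"
    if "x \<in> X_space p" "y \<in> X_space q" for x y
  proof -
    have "norm (matrix_form n a x y) \<le> (\<Sum>j<n. \<Sum>k<n. norm (x j * y k * a j k))"
      unfolding matrix_form_def by (intro sum_norm_le) simp
    also have "\<dots> \<le> (\<Sum>j<n. \<Sum>k<n. X_norm p x * X_norm q y * norm (a j k))"
      unfolding norm_mult using that
      by (intro sum_mono mult_mono norm_le_X_norm pq X_norm_nonneg mult_nonneg_nonneg) auto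
    finally show ?thesis
      by (simp add: sum_distrib_left mult_ac)
  qed
  then have "\<exists>M. \<forall>x\<in>X_space p. \<forall>y\<in>X_space q. norm (matrix_form n a x y) \<le> M * X_norm p x * X_norm q y"
    by blast
  moreover have "matrix_form n a (\<lambda>i. c * x i + d * x' i) y = c * matrix_form n a x y + d * matrix_form n a x' y"
    "matrix_form n a x (\<lambda>i. c * y i + d * y' i) = c * matrix_form n a x y + d * matrix_form n a x y'"
    for x x' y y' c d
    by (simp_all add: matrix_form_def algebra_simps sum.distrib sum_distrib_left)
  ultimately show ?thesis
    unfolding cont_bilinear_form_def by simp
qed

lemma mixed_le_matrix_form:
  assumes "mixed_le r s (matrix_form n a) B" "0 < r" "0 < s"
  shows "(\<Sum>k<n. (\<Sum>j<n. norm (a j k) powr r) powr (s / r)) powr (1 / s) \<le> B"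
proof -
  have inner: "(\<Sum>j. norm (matrix_form n a (unit_vec j) (unit_vec k)) powr r)
      = (if k < n then \<Sum>j<n. norm (a j k) powr r else 0)" for k
    by (subst suminf_finite[of "{..<n}"]) (auto simp: matrix_form_unit_vec)
  have "(\<Sum>k. (\<Sum>j. norm (matrix_form n a (unit_vec j) (unit_vec k)) powr r) powr (s / r))
      = (\<Sum>k<n. (\<Sum>j<n. norm (a j k) powr r) powr (s / r))"
    unfolding inner by (subst suminf_finite[of "{..<n}"]) auto
  then show ?thesis
    using assms(1) by (simp add: mixed_le_def)
qed

text \<open>Exponents can be compared along the sizes 2^m alone, which are the sizes of the
  Sylvester matrices.\<close>

lemma powr_two_power_unbounded:
  assumes "\<And>m::nat. (2 ^ m) powr a \<le> C * (2 ^ m) powr b"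
  shows "a \<le> (b :: real)"
proof (rule ccontr)
  assume "\<not> a \<le> b"
  then have "1 < (2 :: real) powr (a - b)"
    by simp
  then obtain m where m: "C < (2 powr (a - b)) ^ m"
    using real_arch_pow by blast
  have "(2 powr (a - b)) ^ m = ((2 :: real) ^ m) powr (a - b)"
    by (simp add: powr_powr mult.commute flip: powr_realpow)
  also have "\<dots> = (2 ^ m) powr a / (2 ^ m) powr b"
    by (simp add: powr_diff)
  also have "\<dots> \<le> C"
    using assms[of m] by (simp add: divide_simps)
  finally show False
    using m by simp
qed

text \<open>Hoelder with the three exponents \<alpha>, \<beta> and 1 - \<alpha> - \<beta>, the third
  factor being constant 1. It is obtained from two applications of the two-factor inequality: w
  against v with \<alpha>/t and \<beta>/t, then their product against 1 with t and 1 - t.\<close>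

lemma sum_weights_le:
  fixes w v :: "'i \<Rightarrow> real"
  assumes \<alpha>\<beta>: "0 \<le> \<alpha>" "0 \<le> \<beta>" "\<alpha> + \<beta> \<le> 1"
    and w: "\<And>i. i \<in> A \<Longrightarrow> 0 \<le> w i" "(\<Sum>i\<in>A. w i) \<le> 1"
    and v: "\<And>i. i \<in> A \<Longrightarrow> 0 \<le> v i" "(\<Sum>i\<in>A. v i) \<le> 1"
  shows "(\<Sum>i\<in>A. w i powr \<alpha> * v i powr \<beta>) \<le> real (card A) powr (1 - \<alpha> - \<beta>)"
proof (cases "\<alpha> + \<beta> = 0")
  case True
  then have "\<alpha> = 0" "\<beta> = 0"
    using \<alpha>\<beta> by auto
  then have "(\<Sum>i\<in>A. w i powr \<alpha> * v i powr \<beta>) \<le> (\<Sum>i\<in>A. 1)"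
    by (intro sum_mono) auto
  then show ?thesis
    using \<open>\<alpha> = 0\<close> \<open>\<beta> = 0\<close> by simp
next
  case False
  define t where "t = \<alpha> + \<beta>"
  have t: "0 < t" "t \<le> 1"
    using False \<alpha>\<beta> by (auto simp: t_def)
  have frac: "0 \<le> \<alpha> / t" "\<alpha> / t \<le> 1" "\<beta> / t = 1 - \<alpha> / t"
    using t \<alpha>\<beta> by (auto simp: t_def field_simps)
  define g where "g i = w i powr (\<alpha> / t) * v i powr (\<beta> / t)" for i
  have "(\<Sum>i\<in>A. g i) \<le> (\<Sum>i\<in>A. w i) powr (\<alpha> / t) * (\<Sum>i\<in>A. v i) powr (\<beta> / t)"
    unfolding g_def frac(3) using frac w v by (intro holder_sum) auto
  also have "\<dots> \<le> 1"
    using frac(1) w v t \<alpha>\<beta> by (intro mult_le_one powr_le1) (auto simp: sum_nonneg)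
  finally have g: "(\<Sum>i\<in>A. g i) \<le> 1" .
  have g0: "0 \<le> g i" for i
    by (simp add: g_def)
  have "(\<Sum>i\<in>A. w i powr \<alpha> * v i powr \<beta>) = (\<Sum>i\<in>A. g i powr t * 1 powr (1 - t))"
    using t by (simp add: g_def powr_mult powr_powr)
  also have "\<dots> \<le> (\<Sum>i\<in>A. g i) powr t * (\<Sum>i\<in>A. 1) powr (1 - t)"
    using t g0 by (intro holder_sum) auto
  also have "\<dots> \<le> 1 * real (card A) powr (1 - t)"
    using t g g0 by (intro mult_mono powr_le1) (auto simp: sum_nonneg)
  finally show ?thesis
    by (simp add: t_def diff_diff_eq)
qed

text \<open>Each column of the identity matrix has norm 1, so its mixed sum is n^(1/s), against a
  form norm of at most n^(1/l).\<close>

lemma not_mixed_le_2_bil_norm: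
  assumes pq: "2 \<le> p" "2 \<le> q" "inv_exp p + inv_exp q < 1"
    and l: "l = 1 / (1 - inv_exp p - inv_exp q)" and s: "0 < s" "s < l"
  shows "\<not> (\<exists>C. \<forall>A :: (nat \<Rightarrow> 'k::real_normed_field) \<Rightarrow> (nat \<Rightarrow> 'k) \<Rightarrow> 'k.
           cont_bilinear_form p q A \<longrightarrow> mixed_le 2 s A (C * bil_norm p q A))"
proof
  assume "\<exists>C. \<forall>A :: (nat \<Rightarrow> 'k) \<Rightarrow> (nat \<Rightarrow> 'k) \<Rightarrow> 'k.
            cont_bilinear_form p q A \<longrightarrow> mixed_le 2 s A (C * bil_norm p q A)"
  then obtain C where C: "\<And>A :: (nat \<Rightarrow> 'k) \<Rightarrow> (nat \<Rightarrow> 'k) \<Rightarrow> 'k.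
      cont_bilinear_form p q A \<Longrightarrow> mixed_le 2 s A (C * bil_norm p q A)"
    by blast
  have "(2 ^ m) powr (1 / s) \<le> \<bar>C\<bar> * (2 ^ m) powr (1 / l)" for m
  proof -
    define n :: nat where "n = 2 ^ m"
    define a :: "nat \<Rightarrow> nat \<Rightarrow> 'k" where "a j k = (if j = k then 1 else 0)" for j k
    let ?A = "matrix_form n a"
    have cont: "cont_bilinear_form p q ?A"
      by (rule cont_bilinear_form_matrix_form[OF pq(1,2)])
    have "bil_norm p q ?A \<le> real n powr (1 / l)"
    proof (rule bil_norm_leI[OF pq(1,2)])
      fix x y :: "nat \<Rightarrow> 'k"
      assume x: "x \<in> X_space p" "X_norm p x \<le> 1" and y: "y \<in> X_space q" "X_norm q y \<le> 1"
      obtain w where w: "\<And>j. 0 \<le> w j" "\<And>j. j < n \<Longrightarrow> norm (x j) \<le> w j powr inv_exp p" "(\<Sum>j<n. w j) \<le> 1"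
        using X_norm_le_1_weights[OF pq(1) x] by blast
      obtain v where v: "\<And>j. 0 \<le> v j" "\<And>j. j < n \<Longrightarrow> norm (y j) \<le> v j powr inv_exp q" "(\<Sum>j<n. v j) \<le> 1"
        using X_norm_le_1_weights[OF pq(2) y] by blast
      have "?A x y = (\<Sum>j<n. x j * y j)"
        by (auto simp: matrix_form_def a_def if_distrib cong: if_cong intro!: sum.cong)
      then have "norm (?A x y) \<le> (\<Sum>j<n. w j powr inv_exp p * v j powr inv_exp q)"
        by (auto simp: norm_mult intro!: sum_norm_le mult_mono w v)
      also have "\<dots> \<le> real (card {..<n}) powr (1 - inv_exp p - inv_exp q)"
        using w v pq inv_exp_bounds by (intro sum_weights_le) auto
      finally show "norm (?A x y) \<le> real n powr (1 / l)"
        by (simp add: l)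
    qed
    moreover have "0 \<le> bil_norm p q ?A"
      by (rule bil_norm_nonneg[OF pq(1,2) cont])
    \<comment> \<open>The constant C may be negative, hence |C|.\<close>
    ultimately have bound: "C * bil_norm p q ?A \<le> \<bar>C\<bar> * real n powr (1 / l)"
      by (intro mult_mono) auto
    have "(\<Sum>j<n. norm (a j k) powr 2) = 1" if "k < n" for k
      using that by (simp add: a_def if_distrib[of norm] if_distrib[of "\<lambda>t. t powr 2"] cong: if_cong)
    then have "(\<Sum>k<n. (\<Sum>j<n. norm (a j k) powr 2) powr (s / 2)) = real n"
      by simp
    with mixed_le_matrix_form[OF C[OF cont]] s have "real n powr (1 / s) \<le> C * bil_norm p q ?A"
      by simp
    with bound show ?thesis
      by (simp add: n_def)
  qed
  then have "1 / s \<le> 1 / l"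
    by (rule powr_two_power_unbounded)
  with s show False
    by (simp add: field_simps)
qed

text \<open>The block recursion [[H, H], [H, -H]]: reduction modulo 2^m locates an index within its
  block, and only the lower right block changes sign.\<close>

fun sylvester :: "nat \<Rightarrow> nat \<Rightarrow> nat \<Rightarrow> real" where
  "sylvester 0 j k = 1"
| "sylvester (Suc m) j k = (if 2 ^ m \<le> j \<and> 2 ^ m \<le> k then -1 else 1) * sylvester m (j mod 2 ^ m) (k mod 2 ^ m)"

lemma abs_sylvester: "\<bar>sylvester m j k\<bar> = 1"
  by (induction m arbitrary: j k) (auto simp: abs_mult)

lemma sum_lessThan_double:
  fixes f :: "nat \<Rightarrow> 'a::comm_monoid_add"
  shows "(\<Sum>k<2 * n. f k) = (\<Sum>k<n. f k) + (\<Sum>k<n. f (k + n))"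
proof -
  have "(\<Sum>k<2 * n. f k) = (\<Sum>k=0..<n. f k) + (\<Sum>k=n..<n + n. f k)"
    by (simp add: sum.atLeastLessThan_concat mult_2 flip: atLeast0LessThan)
  then show ?thesis
    using sum.shift_bounds_nat_ivl[of f 0 n n] by (simp add: atLeast0LessThan)
qed

text \<open>The columns are orthogonal with squared norm 2^m. On the two halves y', y'' of y, the
  upper rows act as the smaller matrix on y' + y'' and the lower rows on y' - y''; the parallelogram
  law recombines them.\<close>

lemma sylvester_isometry:
  fixes y :: "nat \<Rightarrow> 'v::real_inner"
  shows "(\<Sum>j<2 ^ m. (norm (\<Sum>k<2 ^ m. sylvester m j k *\<^sub>R y k))\<^sup>2) = 2 ^ m * (\<Sum>k<2 ^ m. (norm (y k))\<^sup>2)"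
proof (induction m arbitrary: y)
  case 0
  then show ?case by simp
next
  case (Suc m)
  let ?n = "2 ^ m :: nat"
  have lower: "(\<Sum>k<2 * ?n. sylvester (Suc m) j k *\<^sub>R y k)
      = (\<Sum>k<?n. sylvester m j k *\<^sub>R (y k + y (k + ?n)))" if "j < ?n" for j
    using that by (simp add: sum_lessThan_double scaleR_add_right sum.distrib)
  have upper: "(\<Sum>k<2 * ?n. sylvester (Suc m) (j + ?n) k *\<^sub>R y k)
      = (\<Sum>k<?n. sylvester m j k *\<^sub>R (y k - y (k + ?n)))" if "j < ?n" for j
    using that by (simp add: sum_lessThan_double scaleR_diff_right sum_subtractf sum_negf)
  have "(\<Sum>j<2 ^ Suc m. (norm (\<Sum>k<2 ^ Suc m. sylvester (Suc m) j k *\<^sub>R y k))\<^sup>2)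
      = (\<Sum>j<?n. (norm (\<Sum>k<?n. sylvester m j k *\<^sub>R (y k + y (k + ?n))))\<^sup>2)
        + (\<Sum>j<?n. (norm (\<Sum>k<?n. sylvester m j k *\<^sub>R (y k - y (k + ?n))))\<^sup>2)"
    unfolding power_Suc sum_lessThan_double[where f = "\<lambda>j. (norm (\<Sum>k<2 * ?n. _ j k))\<^sup>2"]
    using lower upper by (intro arg_cong2[of _ _ _ _ "(+)"] sum.cong) auto
  also have "\<dots> = 2 ^ m * (\<Sum>k<?n. (norm (y k - y (k + ?n)))\<^sup>2 + (norm (y k + y (k + ?n)))\<^sup>2)"
    unfolding Suc.IH by (simp add: sum.distrib algebra_simps)
  also have "\<dots> = 2 ^ Suc m * (\<Sum>k<2 ^ Suc m. (norm (y k))\<^sup>2)"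
    unfolding parallelogram_law power_Suc sum_lessThan_double
    by (simp add: sum.distrib algebra_simps flip: sum_distrib_left)
  finally show ?case .
qed

text \<open>All entries have modulus 1, so the mixed sum is n^(1/l + 1/r), whereas near-isometry
  keeps the form norm below n^(1/l + 1/2).\<close>

lemma not_mixed_le_bil_norm_below_2:
  assumes pq: "2 \<le> p" "2 \<le> q" "inv_exp p + inv_exp q < 1"
    and l: "l = 1 / (1 - inv_exp p - inv_exp q)" and r: "0 < r" "r < 2"
  shows "\<not> (\<exists>C. \<forall>A :: (nat \<Rightarrow> 'k::{real_normed_field,real_inner}) \<Rightarrow> (nat \<Rightarrow> 'k) \<Rightarrow> 'k.
           cont_bilinear_form p q A \<longrightarrow> mixed_le r l A (C * bil_norm p q A))"
proof
  assume "\<exists>C. \<forall>A :: (nat \<Rightarrow> 'k) \<Rightarrow> (nat \<Rightarrow> 'k) \<Rightarrow> 'k.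
            cont_bilinear_form p q A \<longrightarrow> mixed_le r l A (C * bil_norm p q A)"
  then obtain C where C: "\<And>A :: (nat \<Rightarrow> 'k) \<Rightarrow> (nat \<Rightarrow> 'k) \<Rightarrow> 'k.
      cont_bilinear_form p q A \<Longrightarrow> mixed_le r l A (C * bil_norm p q A)"
    by blast
  have lpos: "l > 0"
    using l pq by simp
  have "(2 ^ m) powr (1 / l + 1 / r) \<le> \<bar>C\<bar> * (2 ^ m) powr (1 / l + 1 / 2)" for m
  proof -
    define n :: nat where "n = 2 ^ m"
    define a :: "nat \<Rightarrow> nat \<Rightarrow> 'k" where "a j k = of_real (sylvester m j k)" for j k
    let ?A = "matrix_form n a"
    have n: "n > 0"
      by (simp add: n_def)
    have cont: "cont_bilinear_form p q ?A"
      by (rule cont_bilinear_form_matrix_form[OF pq(1,2)])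
    \<comment> \<open>Comparison of the Euclidean norm with the p'-norm on n coordinates:
      \<open>sum_weights_le\<close> with the same weights used twice, where p' \<ge> 2 gives 2/p'
      \<le> 1.\<close>
    have l2: "(\<Sum>j<n. (norm (x j))\<^sup>2) \<le> real n powr (1 - 2 * inv_exp p')"
      if p': "2 \<le> p'" and x: "x \<in> X_space p'" "X_norm p' x \<le> 1" for p' and x :: "nat \<Rightarrow> 'k"
    proof -
      obtain w where w: "\<And>j. 0 \<le> w j" "\<And>j. j < n \<Longrightarrow> norm (x j) \<le> w j powr inv_exp p'" "(\<Sum>j<n. w j) \<le> 1"
        using X_norm_le_1_weights[OF p' x] by blast
      have "(\<Sum>j<n. (norm (x j))\<^sup>2) \<le> (\<Sum>j<n. w j powr inv_exp p' * w j powr inv_exp p')"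
        unfolding power2_eq_square by (intro sum_mono mult_mono w) auto
      also have "\<dots> \<le> real (card {..<n}) powr (1 - inv_exp p' - inv_exp p')"
        using w inv_exp_bounds[OF p'] by (intro sum_weights_le) auto
      finally show ?thesis
        by (simp add: algebra_simps)
    qed
    have "bil_norm p q ?A \<le> real n powr (1 / l + 1 / 2)"
    proof (rule bil_norm_leI[OF pq(1,2)])
      fix x y :: "nat \<Rightarrow> 'k"
      assume x: "x \<in> X_space p" "X_norm p x \<le> 1" and y: "y \<in> X_space q" "X_norm q y \<le> 1"
      define z where "z j = (\<Sum>k<n. sylvester m j k *\<^sub>R y k)" for j
      have "?A x y = (\<Sum>j<n. x j * z j)"
        by (simp add: matrix_form_def z_def a_def scaleR_conv_of_real sum_distrib_left mult_ac)
      then have "norm (?A x y) \<le> (\<Sum>j<n. norm (x j) * norm (z j))"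
        by (auto simp: norm_mult intro!: sum_norm_le)
      then have "(norm (?A x y))\<^sup>2 \<le> (\<Sum>j<n. norm (x j) * norm (z j))\<^sup>2"
        by (intro power_mono) auto
      also have "\<dots> \<le> (\<Sum>j<n. (norm (x j))\<^sup>2) * (\<Sum>j<n. (norm (z j))\<^sup>2)"
        by (rule Cauchy_Schwarz_ineq_sum)
      also have "(\<Sum>j<n. (norm (z j))\<^sup>2) = real n * (\<Sum>k<n. (norm (y k))\<^sup>2)"
        unfolding z_def n_def by (simp add: sylvester_isometry)
      also have "(\<Sum>j<n. (norm (x j))\<^sup>2) * (real n * (\<Sum>k<n. (norm (y k))\<^sup>2))
          \<le> real n powr (1 - 2 * inv_exp p) * (real n powr 1 * real n powr (1 - 2 * inv_exp q))"
        using l2[OF pq(1) x] l2[OF pq(2) y] by (intro mult_mono mult_nonneg_nonneg sum_nonneg) auto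
      \<comment> \<open>The exponents add up to 3 - 2/p - 2/q = 2 (1/l + 1/2).\<close>
      also have "\<dots> = (real n powr (1 / l + 1 / 2)) powr 2"
        unfolding powr_add[symmetric] powr_powr by (simp add: l algebra_simps)
      finally show "norm (?A x y) \<le> real n powr (1 / l + 1 / 2)"
        by (auto intro: power2_le_imp_le)
    qed
    moreover have "0 \<le> bil_norm p q ?A"
      by (rule bil_norm_nonneg[OF pq(1,2) cont])
    ultimately have bound: "C * bil_norm p q ?A \<le> \<bar>C\<bar> * real n powr (1 / l + 1 / 2)"
      by (intro mult_mono) auto
    have "(\<Sum>k<n. (\<Sum>j<n. norm (a j k) powr r) powr (l / r)) = real n powr (1 + l / r)"
      using n by (simp add: a_def abs_sylvester powr_add)
    then have "(\<Sum>k<n. (\<Sum>j<n. norm (a j k) powr r) powr (l / r)) powr (1 / l) = real n powr (1 / l + 1 / r)"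
      using lpos by (simp add: powr_powr algebra_simps)
    with mixed_le_matrix_form[OF C[OF cont]] r lpos have "real n powr (1 / l + 1 / r) \<le> C * bil_norm p q ?A"
      by simp
    with bound show ?thesis
      by (simp add: n_def)
  qed
  then have "1 / l + 1 / r \<le> 1 / l + 1 / 2"
    by (rule powr_two_power_unbounded)
  with r show False
    by (simp add: field_simps)
qed

theorem theorem6:
  fixes p q :: ereal and lam :: real
  assumes "2 \<le> p" and "2 \<le> q"
    and "inv_exp p + inv_exp q < 1"
    and "lam = 1 / (1 - inv_exp p - inv_exp q)"
  shows
    \<comment> \<open>K = \<real>\<close>
    "(\<exists>C\<ge>1. \<forall>A :: (nat \<Rightarrow> real) \<Rightarrow> (nat \<Rightarrow> real) \<Rightarrow> real.
        cont_bilinear_form p q A \<longrightarrow> mixed_le 2 lam A (C * bil_norm p q A)) \<and>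
     (\<forall>s. 0 < s \<and> s < lam \<longrightarrow> \<not> (\<exists>C. \<forall>A :: (nat \<Rightarrow> real) \<Rightarrow> (nat \<Rightarrow> real) \<Rightarrow> real.
        cont_bilinear_form p q A \<longrightarrow> mixed_le 2 s A (C * bil_norm p q A))) \<and>
     (\<forall>r. 0 < r \<and> r < 2 \<longrightarrow> \<not> (\<exists>C. \<forall>A :: (nat \<Rightarrow> real) \<Rightarrow> (nat \<Rightarrow> real) \<Rightarrow> real.
        cont_bilinear_form p q A \<longrightarrow> mixed_le r lam A (C * bil_norm p q A))) \<and>
     \<comment> \<open>K = \<complex>\<close>
     (\<exists>C\<ge>1. \<forall>A :: (nat \<Rightarrow> complex) \<Rightarrow> (nat \<Rightarrow> complex) \<Rightarrow> complex.
        cont_bilinear_form p q A \<longrightarrow> mixed_le 2 lam A (C * bil_norm p q A)) \<and>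
     (\<forall>s. 0 < s \<and> s < lam \<longrightarrow> \<not> (\<exists>C. \<forall>A :: (nat \<Rightarrow> complex) \<Rightarrow> (nat \<Rightarrow> complex) \<Rightarrow> complex.
        cont_bilinear_form p q A \<longrightarrow> mixed_le 2 s A (C * bil_norm p q A))) \<and>
     (\<forall>r. 0 < r \<and> r < 2 \<longrightarrow> \<not> (\<exists>C. \<forall>A :: (nat \<Rightarrow> complex) \<Rightarrow> (nat \<Rightarrow> complex) \<Rightarrow> complex.
        cont_bilinear_form p q A \<longrightarrow> mixed_le r lam A (C * bil_norm p q A)))"
proof (intro conjI allI impI)
  \<comment> \<open>The constant is that of Khinchin's inequality, for both scalar fields.\<close>
  show "\<exists>C\<ge>1. \<forall>A :: (nat \<Rightarrow> real) \<Rightarrow> (nat \<Rightarrow> real) \<Rightarrow> real.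
      cont_bilinear_form p q A \<longrightarrow> mixed_le 2 lam A (C * bil_norm p q A)"
    by (rule exI[of _ "9 / 5"]) (use mixed_le_2_bil_norm[OF assms] in auto)
  show "\<exists>C\<ge>1. \<forall>A :: (nat \<Rightarrow> complex) \<Rightarrow> (nat \<Rightarrow> complex) \<Rightarrow> complex.
      cont_bilinear_form p q A \<longrightarrow> mixed_le 2 lam A (C * bil_norm p q A)"
    by (rule exI[of _ "9 / 5"]) (use mixed_le_2_bil_norm[OF assms] in auto)
qed (use not_mixed_le_2_bil_norm[OF assms] not_mixed_le_bil_norm_below_2[OF assms] in blast)+

end
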